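(* Consider a graph-based Markov decision process with $n$ agents, influence graph $(\mathcal V,\mathcal E)$ and bounded local rewards; in particular the global reward factorises as $r^t=n^{-1}\sum_{i\in\mathcal V}R_i^t$. Let $\gamma\in(0,1)$ and $\Gamma=\gamma\,\mathbb A D^{-1}$. For a joint policy $\pi$ let $$V_D^\pi(S)=\mathbb E_\pi\Big[\sum_{t=0}^\infty\Gamma^{t+1}R^t\;\Big|\;S^0=S\Big]\in\mathbb R^n,\qquad V^\pi(S)=\mathbb E_\pi\Big[\sum_{t=0}^\infty\gamma^{t+1}r^t\;\Big|\;S^0=S\Big]\in\mathbb R$$ be its diffusion value function and its global value function. Let $\pi$ and $\pi'$ be two joint policies. For any state $S$, if $(V_D^{\pi'}(S))_i\ge (V_D^{\pi}(S))_i$ for all agents $i\in\mathcal V$, with strict inequality for at least one agent, then $$V^{\pi'}(S)>V^{\pi}(S).$$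
   Context: Graph-based Markov decision process (GMDP). Agents are indexed by $\mathcal V=\{1,\dots,n\}$. Agent $i$ has local state space $\mathcal S_i$ and action space $\mathcal A_i$; there is an additional space $\mathcal S_0$ of global/unobserved state variables. The joint spaces are $\mathcal S=\prod_{i\in\mathcal V\cup\{0\}}\mathcal S_i$ and $\mathcal A=\prod_{i\in\mathcal V}\mathcal A_i$ (measurable spaces; all functions and kernels are measurable). The influence graph $(\mathcal V,\mathcal E)$ is a directed graph with $(i,i)\in\mathcal E$ for all $i$. For a node $i$ let $N_i^{\mathrm{in}}=\{j:(j,i)\in\mathcal E\}$, and for $N\subseteq\mathcal V$ write $X_N=(X_j)_{j\in N}$. Rewards and transitions factorise as $$\mathcal R(S,A)=n^{-1}\sum_{i\in\mathcal V}\mathcal R_i(S_{N_i^{\mathrm{in}}},S_0;A_{N_i^{\mathrm{in}}}),\qquad T(S'|S,A)=T_0(S_0'|S_0)\prod_{i\in\mathcal V}T_i(S_i'|S_{N_i^{\mathrm{in}}},S_0;A_{N_i^{\mathrm{in}}}).$$ At time $t$ the state is $S^t$, the joint action is $A^t$, and $S^{t+1}\sim T(\cdot|S^t,A^t)$. The local reward at node $i$ is $R_i^t=\mathcal R_i(S^t_{N_i^{\mathrm{in}}},S_0^t;A^t_{N_i^{\mathrm{in}}})\in\mathbb R$, $R^t=(R_1^t,\dots,R_n^t)^\top$, and the global reward is $r^t=\mathcal R(S^t,A^t)$. A joint policy is $\pi=(\pi_1,\dots,\pi_n)$, where $\pi_i$ maps the local history $\tau_i^t=(S_i^{0:t},A_i^{0:t-1})$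 to a distribution over $\mathcal A_i$; given the histories, agents draw their actions independently. $\mathbb E_\pi$ denotes expectation under the resulting process. $\mathbb A\in\{0,1\}^{n\times n}$ is the adjacency matrix of the influence graph ($\mathbb A_{ij}=1$ iff $(i,j)\in\mathcal E$), and $D$ is the diagonal in-degree matrix, $D_{ii}=\sum_j\mathbb A_{ji}$ (positive by self-connectedness). *)

theory Defs
  imports "HOL-Probability.Probability"
begin

text \<open>
  The agents are the elements of a finite type \<open>'n\<close>.  All local state spaces share the carrier
  type \<open>'s\<close> and all local action spaces the carrier type \<open>'a\<close>, but each agent has its own measurable
  space on that type.  A joint state is a pair of the global component \<open>S_0\<close> and the family of local
  states.  A local reward or kernel of agent \<open>i\<close> takes
  \<open>(((S_j)_{j \<in> N_i}, S_0), (A_j)_{j \<in> N_i})\<close>, where \<open>N_i\<close> is the in-neighbourhood of \<open>i\<close>.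
\<close>

type_synonym ('n, 'z, 's) state = "'z \<times> ('n \<Rightarrow> 's)"
type_synonym ('n, 'z, 's, 'a) local_input = "(('n \<Rightarrow> 's) \<times> 'z) \<times> ('n \<Rightarrow> 'a)"
type_synonym ('n, 'z, 's, 'a) trajectory = "nat \<Rightarrow> ('n, 'z, 's) state \<times> ('n \<Rightarrow> 'a)"
type_synonym ('n, 's, 'a) policy = "'n \<Rightarrow> nat \<Rightarrow> (nat \<Rightarrow> 's) \<times> (nat \<Rightarrow> 'a) \<Rightarrow> 'a measure"

record ('n, 'z, 's, 'a) gmdp =
  edges :: "('n \<times> 'n) set"
  global_space :: "'z measure"
  local_space :: "'n \<Rightarrow> 's measure"
  action_space :: "'n \<Rightarrow> 'a measure"
  local_reward :: "'n \<Rightarrow> ('n, 'z, 's, 'a) local_input \<Rightarrow> real"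
  global_kernel :: "'z \<Rightarrow> 'z measure"
  local_kernel :: "'n \<Rightarrow> ('n, 'z, 's, 'a) local_input \<Rightarrow> 's measure"

definition in_nbrs :: "('n, 'z, 's, 'a) gmdp \<Rightarrow> 'n \<Rightarrow> 'n set" where
  "in_nbrs G i = {j. (j, i) \<in> edges G}"

definition state_space :: "('n, 'z, 's, 'a) gmdp \<Rightarrow> ('n, 'z, 's) state measure" where
  "state_space G = global_space G \<Otimes>\<^sub>M PiM UNIV (local_space G)"

definition joint_action_space :: "('n, 'z, 's, 'a) gmdp \<Rightarrow> ('n \<Rightarrow> 'a) measure" where
  "joint_action_space G = PiM UNIV (action_space G)"

definition local_input_space ::
    "('n, 'z, 's, 'a) gmdp \<Rightarrow> 'n \<Rightarrow> ('n, 'z, 's, 'a) local_input measure" where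
  "local_input_space G i =
     (PiM (in_nbrs G i) (local_space G) \<Otimes>\<^sub>M global_space G) \<Otimes>\<^sub>M PiM (in_nbrs G i) (action_space G)"

definition local_view ::
    "('n, 'z, 's, 'a) gmdp \<Rightarrow> 'n \<Rightarrow> ('n, 'z, 's) state \<times> ('n \<Rightarrow> 'a) \<Rightarrow> ('n, 'z, 's, 'a) local_input"
  where "local_view G i = (\<lambda>((z, s), a).
           ((restrict s (in_nbrs G i), z), restrict a (in_nbrs G i)))"

definition gmdp :: "('n::finite, 'z, 's, 'a) gmdp \<Rightarrow> bool" where
  "gmdp G \<longleftrightarrow>
     (\<forall>i. (i, i) \<in> edges G) \<and>
     (\<forall>i. local_reward G i \<in> borel_measurable (local_input_space G i)) \<and>
     global_kernel G \<in> global_space G \<rightarrow>\<^sub>M prob_algebra (global_space G) \<and>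
     (\<forall>i. local_kernel G i \<in> local_input_space G i \<rightarrow>\<^sub>M prob_algebra (local_space G i))"

definition bounded_local_rewards :: "('n, 'z, 's, 'a) gmdp \<Rightarrow> bool" where
  "bounded_local_rewards G \<longleftrightarrow>
     (\<exists>B. \<forall>i. \<forall>x \<in> space (local_input_space G i). \<bar>local_reward G i x\<bar> \<le> B)"

definition local_rewards ::
    "('n::finite, 'z, 's, 'a) gmdp \<Rightarrow> ('n, 'z, 's) state \<times> ('n \<Rightarrow> 'a) \<Rightarrow> real ^ 'n" where
  "local_rewards G x = (\<chi> i. local_reward G i (local_view G i x))"

definition global_reward ::
    "('n::finite, 'z, 's, 'a) gmdp \<Rightarrow> ('n, 'z, 's) state \<times> ('n \<Rightarrow> 'a) \<Rightarrow> real" where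
  "global_reward G x = (\<Sum>i\<in>UNIV. local_reward G i (local_view G i x)) / real CARD('n)"

definition transition ::
    "('n::finite, 'z, 's, 'a) gmdp \<Rightarrow> ('n, 'z, 's) state \<times> ('n \<Rightarrow> 'a) \<Rightarrow> ('n, 'z, 's) state measure"
  where "transition G x =
    global_kernel G (fst (fst x)) \<Otimes>\<^sub>M PiM UNIV (\<lambda>i. local_kernel G i (local_view G i x))"

definition history_space :: "('n, 'z, 's, 'a) gmdp \<Rightarrow> 'n \<Rightarrow> nat \<Rightarrow> ((nat \<Rightarrow> 's) \<times> (nat \<Rightarrow> 'a)) measure"
  where "history_space G i t =
    PiM {..t} (\<lambda>_. local_space G i) \<Otimes>\<^sub>M PiM {..<t} (\<lambda>_. action_space G i)"

definition joint_policy :: "('n, 'z, 's, 'a) gmdp \<Rightarrow> ('n, 's, 'a) policy \<Rightarrow> bool" where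
  "joint_policy G \<pi> \<longleftrightarrow> (\<forall>i t. \<pi> i t \<in> history_space G i t \<rightarrow>\<^sub>M prob_algebra (action_space G i))"

text \<open>
  The local history \<open>(S_i^{0:t}, A_i^{0:t-1})\<close> when the states and actions before time \<open>t\<close> are given
  by \<open>\<omega>\<close> and the joint state at time \<open>t\<close> is \<open>s\<close>.
\<close>

definition local_history ::
    "'n \<Rightarrow> nat \<Rightarrow> ('n, 'z, 's, 'a) trajectory \<Rightarrow> ('n, 'z, 's) state \<Rightarrow> (nat \<Rightarrow> 's) \<times> (nat \<Rightarrow> 'a)" where
  "local_history i t \<omega> s =
     (\<lambda>k\<in>{..t}. if k < t then snd (fst (\<omega> k)) i else snd s i, \<lambda>k\<in>{..<t}. snd (\<omega> k) i)"

definition joint_action_law ::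
    "('n::finite, 's, 'a) policy \<Rightarrow> nat \<Rightarrow> ('n, 'z, 's, 'a) trajectory \<Rightarrow> ('n, 'z, 's) state
      \<Rightarrow> ('n \<Rightarrow> 'a) measure" where
  "joint_action_law \<pi> t \<omega> s = PiM UNIV (\<lambda>i. \<pi> i t (local_history i t \<omega> s))"

definition step_space ::
    "('n, 'z, 's, 'a) gmdp \<Rightarrow> (('n, 'z, 's) state \<times> ('n \<Rightarrow> 'a)) measure" where
  "step_space G = state_space G \<Otimes>\<^sub>M joint_action_space G"

definition next_state_law ::
    "('n::finite, 'z, 's, 'a) gmdp \<Rightarrow> ('n, 'z, 's) state \<Rightarrow> nat \<Rightarrow> ('n, 'z, 's, 'a) trajectory
      \<Rightarrow> ('n, 'z, 's) state measure" where
  "next_state_law G s0 t \<omega> =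
     (case t of 0 \<Rightarrow> return (state_space G) s0 | Suc u \<Rightarrow> transition G (\<omega> u))"

text \<open>The conditional law of \<open>(S^t, A^t)\<close> given \<open>(S^k, A^k)\<close> for \<open>k < t\<close>, started in \<open>s0\<close>.\<close>

definition step_kernel ::
    "('n::finite, 'z, 's, 'a) gmdp \<Rightarrow> ('n, 's, 'a) policy \<Rightarrow> ('n, 'z, 's) state \<Rightarrow> nat
      \<Rightarrow> ('n, 'z, 's, 'a) trajectory \<Rightarrow> (('n, 'z, 's) state \<times> ('n \<Rightarrow> 'a)) measure" where
  "step_kernel G \<pi> s0 t \<omega> =
     next_state_law G s0 t \<omega> \<bind> (\<lambda>s.
     joint_action_law \<pi> t \<omega> s \<bind> (\<lambda>a.
     return (step_space G) (s, a)))"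

text \<open>
  The law of \<open>(S^t, A^t)_t\<close> under \<open>\<pi>\<close> with \<open>S^0 = s0\<close>, i.e. the Ionescu-Tulcea extension of the step
  kernels.  Conditioning on \<open>S^0 = s0\<close> is understood as starting the process in \<open>s0\<close>.
\<close>

definition trajectory_law ::
    "('n::finite, 'z, 's, 'a) gmdp \<Rightarrow> ('n, 's, 'a) policy \<Rightarrow> ('n, 'z, 's) state
      \<Rightarrow> ('n, 'z, 's, 'a) trajectory measure" where
  "trajectory_law G \<pi> s0 =
     projective_family.lim UNIV
       (Ionescu_Tulcea.CI (step_kernel G \<pi> s0) (\<lambda>_. step_space G)) (\<lambda>_. step_space G)"

text \<open>
  The following facts show that the hypotheses of the Ionescu-Tulcea construction are met, so that
  \<open>trajectory_law\<close> is indeed the extension of the step kernels.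
\<close>

lemma measurable_PiM_kernel:
  fixes K :: "'i::finite \<Rightarrow> 'b \<Rightarrow> 'c measure"
  assumes K: "\<And>i. K i \<in> M \<rightarrow>\<^sub>M prob_algebra (N i)"
  shows "(\<lambda>x. PiM UNIV (\<lambda>i. K i x)) \<in> M \<rightarrow>\<^sub>M prob_algebra (PiM UNIV N)"
proof (rule measurable_prob_algebra_generated[OF sets_PiM Int_stable_prod_algebra prod_algebra_sets_into_space])
  have Ks: "prob_space (K i x) \<and> sets (K i x) = sets (N i)" if "x \<in> space M" for i x
    using measurable_space[OF K that] by (simp add: space_prob_algebra)
  show "prob_space (PiM UNIV (\<lambda>i. K i x))" if "x \<in> space M" for x
    using Ks[OF that] by (intro prob_space_PiM) auto
  show "sets (PiM UNIV (\<lambda>i. K i x)) = sets (PiM UNIV N)" if "x \<in> space M" for x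
    using Ks[OF that] by (intro sets_PiM_cong) auto
  fix A assume "A \<in> prod_algebra UNIV N"
  then obtain E where A: "A = PiE UNIV E" and E: "\<And>i. E i \<in> sets (N i)"
    by (auto simp: prod_algebra_eq_finite)
  have "emeasure (PiM UNIV (\<lambda>i. K i x)) A = (\<Prod>i\<in>UNIV. emeasure (K i x) (E i))"
    if x: "x \<in> space M" for x
  proof -
    interpret product_prob_space "\<lambda>i. K i x" UNIV
      using Ks[OF x]
      by (simp add: product_prob_space_def product_prob_space_axioms_def product_sigma_finite_def prob_space_imp_sigma_finite)
    show ?thesis unfolding A using E Ks[OF x] by (intro emeasure_PiM) auto
  qed
  moreover have "(\<lambda>x. \<Prod>i\<in>UNIV. emeasure (K i x) (E i)) \<in> borel_measurable M"
    by (intro borel_measurable_prod_ennreal measurable_compose[OF measurable_prob_algebraD[OF K] measurable_emeasure_subprob_algebra] E)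
  ultimately show "(\<lambda>x. emeasure (PiM UNIV (\<lambda>i. K i x)) A) \<in> borel_measurable M"
    by (simp cong: measurable_cong)
qed

lemma measurable_local_view:
  "local_view G i \<in> step_space G \<rightarrow>\<^sub>M local_input_space G i"
  unfolding local_view_def step_space_def state_space_def joint_action_space_def local_input_space_def
  by (auto simp: split_beta' intro!: measurable_Pair measurable_restrict
      measurable_compose[OF _ measurable_component_singleton]
      measurable_compose[OF measurable_fst] measurable_compose[OF measurable_snd] measurable_ident)

lemma measurable_transition:
  assumes "gmdp G"
  shows "transition G \<in> step_space G \<rightarrow>\<^sub>M prob_algebra (state_space G)"
proof -
  have "(\<lambda>x. global_kernel G (fst (fst x))) \<in> step_space G \<rightarrow>\<^sub>M prob_algebra (global_space G)"
    using assms unfolding gmdp_def step_space_def state_space_def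
    by (intro measurable_compose[OF measurable_compose[OF measurable_fst measurable_fst]]) auto
  moreover have "(\<lambda>x. PiM UNIV (\<lambda>i. local_kernel G i (local_view G i x)))
      \<in> step_space G \<rightarrow>\<^sub>M prob_algebra (PiM UNIV (local_space G))"
    using assms unfolding gmdp_def
    by (intro measurable_PiM_kernel measurable_compose[OF measurable_local_view]) auto
  ultimately show ?thesis
    unfolding transition_def[abs_def] state_space_def by (rule measurable_pair_prob)
qed

lemma measurable_local_history:
  "(\<lambda>(\<omega>, s). local_history i t \<omega> s)
     \<in> PiM {0..<t} (\<lambda>_. step_space G) \<Otimes>\<^sub>M state_space G \<rightarrow>\<^sub>M history_space G i t"
proof -
  let ?P = "PiM {0..<t} (\<lambda>_. step_space G) \<Otimes>\<^sub>M state_space G"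
  have c: "(\<lambda>x. fst x k) \<in> ?P \<rightarrow>\<^sub>M step_space G" if "k < t" for k
    using that by (intro measurable_compose[OF measurable_fst] measurable_component_singleton) auto
  have l: "(\<lambda>s. snd s i) \<in> state_space G \<rightarrow>\<^sub>M local_space G i"
    unfolding state_space_def
    by (intro measurable_compose[OF measurable_snd] measurable_component_singleton) auto
  have a: "(\<lambda>x. snd x i) \<in> step_space G \<rightarrow>\<^sub>M action_space G i"
    unfolding step_space_def joint_action_space_def
    by (intro measurable_compose[OF measurable_snd] measurable_component_singleton) auto
  have f: "fst \<in> step_space G \<rightarrow>\<^sub>M state_space G"
    unfolding step_space_def by simp
  have "(\<lambda>x. if k < t then snd (fst (fst x k)) i else snd (snd x) i) \<in> ?P \<rightarrow>\<^sub>M local_space G i" for k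
    using measurable_compose[OF measurable_compose[OF c f] l, of k] measurable_compose[OF measurable_snd l]
    by (cases "k < t") auto
  moreover have "(\<lambda>x. snd (fst x k) i) \<in> ?P \<rightarrow>\<^sub>M action_space G i" if "k < t" for k
    by (rule measurable_compose[OF c[OF that] a])
  ultimately show ?thesis
    unfolding local_history_def history_space_def split_beta'
    by (intro measurable_Pair measurable_restrict) auto
qed

lemma measurable_step_kernel:
  assumes G: "gmdp G" and \<pi>: "joint_policy G \<pi>" and s0: "s0 \<in> space (state_space G)"
  shows "step_kernel G \<pi> s0 t \<in> PiM {0..<t} (\<lambda>_. step_space G) \<rightarrow>\<^sub>M prob_algebra (step_space G)"
proof -
  let ?H = "PiM {0..<t} (\<lambda>_. step_space G)"
  have 1: "next_state_law G s0 t \<in> ?H \<rightarrow>\<^sub>M prob_algebra (state_space G)"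
  proof (cases t)
    case 0
    have "return (state_space G) s0 \<in> space (prob_algebra (state_space G))"
      using s0 by (simp add: space_prob_algebra prob_space_return)
    then show ?thesis unfolding next_state_law_def using 0 by simp
  next
    case (Suc u)
    then have "(\<lambda>\<omega>. \<omega> u) \<in> ?H \<rightarrow>\<^sub>M step_space G"
      by (intro measurable_component_singleton) simp
    from measurable_compose[OF this measurable_transition[OF G]] show ?thesis
      unfolding next_state_law_def using Suc by simp
  qed
  have 2: "(\<lambda>(\<omega>, s). joint_action_law \<pi> t \<omega> s)
      \<in> ?H \<Otimes>\<^sub>M state_space G \<rightarrow>\<^sub>M prob_algebra (joint_action_space G)"
  proof -
    have "(\<lambda>x. \<pi> i t (local_history i t (fst x) (snd x)))
        \<in> ?H \<Otimes>\<^sub>M state_space G \<rightarrow>\<^sub>M prob_algebra (action_space G i)" for i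
      using measurable_compose[OF measurable_local_history[of i t G], of "\<pi> i t"] \<pi>
      by (simp add: split_beta' joint_policy_def)
    then show ?thesis
      unfolding joint_action_law_def joint_action_space_def split_beta'
      by (rule measurable_PiM_kernel)
  qed
  have 3: "(\<lambda>(\<omega>s, a). return (step_space G) (snd \<omega>s, a))
      \<in> (?H \<Otimes>\<^sub>M state_space G) \<Otimes>\<^sub>M joint_action_space G \<rightarrow>\<^sub>M prob_algebra (step_space G)"
    unfolding split_beta'
    by (rule measurable_compose[OF _ measurable_return_prob_space]) (simp add: step_space_def)
  have "(\<lambda>(\<omega>, s). joint_action_law \<pi> t \<omega> s \<bind> (\<lambda>a. return (step_space G) (s, a)))
      \<in> ?H \<Otimes>\<^sub>M state_space G \<rightarrow>\<^sub>M prob_algebra (step_space G)"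
    using measurable_bind_prob_space2[OF 2 3] by (simp add: split_beta')
  from measurable_bind_prob_space2[OF 1 this] show ?thesis
    unfolding step_kernel_def[abs_def] .
qed

lemma Ionescu_Tulcea_step_kernel:
  assumes "gmdp G" and "joint_policy G \<pi>" and "s0 \<in> space (state_space G)"
  shows "Ionescu_Tulcea (step_kernel G \<pi> s0) (\<lambda>_. step_space G)"
proof (rule Ionescu_Tulcea.intro)
  note K = measurable_step_kernel[OF assms]
  show "step_kernel G \<pi> s0 t \<in> PiM {0..<t} (\<lambda>_. step_space G) \<rightarrow>\<^sub>M subprob_algebra (step_space G)" for t
    by (rule measurable_prob_algebraD[OF K])
  show "prob_space (step_kernel G \<pi> s0 t \<omega>)" if "\<omega> \<in> space (PiM {0..<t} (\<lambda>_. step_space G))" for t \<omega>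
    using measurable_space[OF K that] by (simp add: space_prob_algebra)
qed

definition adjacency :: "('n::finite \<times> 'n) set \<Rightarrow> real ^ 'n ^ 'n" where
  "adjacency E = (\<chi> i j. if (i, j) \<in> E then 1 else 0)"

definition in_degree_matrix :: "('n::finite \<times> 'n) set \<Rightarrow> real ^ 'n ^ 'n" where
  "in_degree_matrix E = (\<chi> i j. if i = j then (\<Sum>k\<in>UNIV. adjacency E $ k $ i) else 0)"

definition diffusion_matrix :: "('n::finite \<times> 'n) set \<Rightarrow> real \<Rightarrow> real ^ 'n ^ 'n" where
  "diffusion_matrix E \<gamma> = \<gamma> *\<^sub>R (adjacency E ** matrix_inv (in_degree_matrix E))"

text \<open>The power operation of the type \<open>real ^ 'n ^ 'n\<close> is componentwise, hence:\<close>

primrec matrix_power :: "real ^ 'n ^ 'n \<Rightarrow> nat \<Rightarrow> real ^ 'n ^ 'n" where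
  "matrix_power M 0 = mat 1"
| "matrix_power M (Suc k) = M ** matrix_power M k"

definition diffusion_value ::
    "('n::finite, 'z, 's, 'a) gmdp \<Rightarrow> real \<Rightarrow> ('n, 's, 'a) policy \<Rightarrow> ('n, 'z, 's) state \<Rightarrow> real ^ 'n"
  where "diffusion_value G \<gamma> \<pi> s =
    (LINT \<omega>|trajectory_law G \<pi> s.
       (\<Sum>t. matrix_power (diffusion_matrix (edges G) \<gamma>) (t + 1) *v local_rewards G (\<omega> t)))"

definition global_value ::
    "('n::finite, 'z, 's, 'a) gmdp \<Rightarrow> real \<Rightarrow> ('n, 's, 'a) policy \<Rightarrow> ('n, 'z, 's) state \<Rightarrow> real"
  where "global_value G \<gamma> \<pi> s =
    (LINT \<omega>|trajectory_law G \<pi> s. (\<Sum>t. \<gamma> ^ (t + 1) * global_reward G (\<omega> t)))"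

end

theory Submission
  imports Defs
begin

text \<open>
  Every column of \<open>A D\<^sup>-\<^sup>1\<close> sums to 1, so the row vector of ones is a left eigenvector of \<open>\<Gamma>\<close> with
  eigenvalue \<open>\<gamma>\<close>.  Summing the entries of the diffusion value over all agents therefore gives \<open>n\<close> times
  the global value.  Since \<open>\<Gamma>\<close> is entrywise nonnegative, it contracts the \<open>l\<^sup>1\<close> norm by \<open>\<gamma>\<close>; with
  bounded rewards this lets the entry sum pass through the series and the expectation.
\<close>

text \<open>The self-loop at \<open>i\<close> contributes 1 to the \<open>i\<close>-th in-degree and
  no other term is negative. The diagonal matrix of reciprocal in-degrees is then a two-sided
  inverse.\<close>

lemma
  fixes E :: "('n::finite \<times> 'n) set"
  assumes "\<And>i. (i, i) \<in> E"
  shows invertible_in_degree_matrix: "invertible (in_degree_matrix E)"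
    and in_degree_pos: "(\<Sum>k\<in>UNIV. adjacency E $ k $ i) > 0"
proof -
  define d where "d i = (\<Sum>k\<in>UNIV. adjacency E $ k $ i)" for i
  have d: "d i > 0" for i
    unfolding d_def by (rule sum_pos2[where i = i]) (auto simp: adjacency_def assms)
  then show "(\<Sum>k\<in>UNIV. adjacency E $ k $ i) > 0"
    by (simp add: d_def)
  define X :: "real ^ 'n ^ 'n" where "X = (\<chi> i j. if i = j then 1 / d i else 0)"
  have D: "in_degree_matrix E $ i $ j = (if i = j then d i else 0)" for i j
    by (simp add: in_degree_matrix_def d_def)
  have "d i \<noteq> 0" for i
    using d[of i] by simp
  then have "in_degree_matrix E ** X = mat 1" "X ** in_degree_matrix E = mat 1"
    by (auto simp: vec_eq_iff matrix_matrix_mult_def X_def D mat_def if_distrib[of "\<lambda>x. x * _"]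
        if_distrib[of "\<lambda>x. _ * x"] cong: if_cong)
  then show "invertible (in_degree_matrix E)"
    unfolding invertible_def by blast
qed

text \<open>Trades \<open>matrix_inv\<close>, a choice among two-sided inverses, for explicit
  entries, from which signs and column sums can be read off.\<close>

lemma diffusion_matrix_nth:
  assumes refl: "\<And>i. (i, i) \<in> E"
  shows "diffusion_matrix E \<gamma> $ i $ j = \<gamma> * adjacency E $ i $ j / (\<Sum>k\<in>UNIV. adjacency E $ k $ j)"
proof -
  let ?D = "in_degree_matrix E" and ?d = "\<lambda>j. \<Sum>k\<in>UNIV. adjacency E $ k $ j"
  have d: "?d l > 0" for l
    by (rule in_degree_pos[OF refl])
  have "?D ** matrix_inv ?D = mat 1"
    using someI_ex[OF invertible_in_degree_matrix[OF refl, unfolded invertible_def]]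
    by (simp add: matrix_inv_def)
  \<comment> \<open>As \<open>?D\<close> is diagonal, each entry of this product has a single
    surviving term, which determines the inverse entrywise.\<close>
  then have "(?D ** matrix_inv ?D) $ l $ j = (mat 1 :: real ^ 'a ^ 'a) $ l $ j" for l
    by simp
  then have "?d l * matrix_inv ?D $ l $ j = (if l = j then 1 else 0)" for l
    by (simp add: matrix_matrix_mult_def in_degree_matrix_def mat_def if_distrib[of "\<lambda>x. x * _"]
        cong: if_cong)
  then have "matrix_inv ?D $ l $ j = (if l = j then 1 else 0) / ?d l" for l
    using d[of l] by (subst eq_divide_eq) (simp add: mult.commute)
  then have "matrix_inv ?D $ l $ j = (if l = j then 1 / ?d j else 0)" for l
    by simp
  then show ?thesis
    by (simp add: diffusion_matrix_def matrix_matrix_mult_def if_distrib[of "\<lambda>x. _ * x"] cong: if_cong)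
qed

lemma diffusion_matrix_nonneg:
  assumes "\<And>i. (i, i) \<in> E" and "\<gamma> \<ge> 0"
  shows "diffusion_matrix E \<gamma> $ i $ j \<ge> 0"
  unfolding diffusion_matrix_nth[OF assms(1)] using assms(2)
  by (intro divide_nonneg_nonneg mult_nonneg_nonneg sum_nonneg) (auto simp: adjacency_def)

text \<open>The in-degree in the denominator is exactly the sum of column \<open>j\<close> of the
  adjacency matrix, so the two cancel.\<close>

lemma diffusion_matrix_column_sum:
  assumes "\<And>i. (i, i) \<in> E"
  shows "(\<Sum>i\<in>UNIV. diffusion_matrix E \<gamma> $ i $ j) = \<gamma>"
  using in_degree_pos[OF assms, of j]
  by (simp add: diffusion_matrix_nth[OF assms] flip: sum_divide_distrib sum_distrib_left)

lemma sum_matrix_vector_mult: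
  fixes M :: "real ^ 'n ^ 'm"
  assumes "\<And>j. (\<Sum>i\<in>UNIV. M $ i $ j) = c"
  shows "(\<Sum>i\<in>UNIV. (M *v x) $ i) = c * (\<Sum>j\<in>UNIV. x $ j)"
proof -
  have "(\<Sum>i\<in>UNIV. (M *v x) $ i) = (\<Sum>j\<in>UNIV. (\<Sum>i\<in>UNIV. M $ i $ j) * x $ j)"
    unfolding matrix_vector_mult_def by (simp add: sum_distrib_right) (rule sum.swap)
  then show ?thesis
    by (simp add: assms sum_distrib_left)
qed

text \<open>For nonnegative entries the triangle inequality bounds \<open>M *v x\<close> by
  \<open>M\<close> applied to the vector of absolute values, whose entry sum is already
  known.\<close>

lemma sum_abs_matrix_vector_mult_le:
  fixes M :: "real ^ 'n ^ 'm"
  assumes "\<And>i j. M $ i $ j \<ge> 0" and "\<And>j. (\<Sum>i\<in>UNIV. M $ i $ j) = c"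
  shows "(\<Sum>i\<in>UNIV. \<bar>(M *v x) $ i\<bar>) \<le> c * (\<Sum>j\<in>UNIV. \<bar>x $ j\<bar>)"
proof -
  have "\<bar>(M *v x) $ i\<bar> \<le> (M *v (\<chi> j. \<bar>x $ j\<bar>)) $ i" for i
    unfolding matrix_vector_mult_def using sum_abs[of "\<lambda>j. M $ i $ j * x $ j" UNIV] assms(1)
    by (simp add: abs_mult)
  then have "(\<Sum>i\<in>UNIV. \<bar>(M *v x) $ i\<bar>) \<le> (\<Sum>i\<in>UNIV. (M *v (\<chi> j. \<bar>x $ j\<bar>)) $ i)"
    by (intro sum_mono)
  also have "\<dots> = c * (\<Sum>j\<in>UNIV. \<bar>x $ j\<bar>)"
    by (subst sum_matrix_vector_mult[OF assms(2)]) simp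
  finally show ?thesis .
qed

lemma sum_matrix_power_mult:
  fixes M :: "real ^ 'n ^ 'n"
  assumes "\<And>j. (\<Sum>i\<in>UNIV. M $ i $ j) = c"
  shows "(\<Sum>i\<in>UNIV. (matrix_power M k *v x) $ i) = c ^ k * (\<Sum>j\<in>UNIV. x $ j)"
  by (induction k) (simp_all add: sum_matrix_vector_mult[OF assms] flip: matrix_vector_mul_assoc)

lemma sum_abs_matrix_power_mult_le:
  fixes M :: "real ^ 'n ^ 'n"
  assumes "\<And>i j. M $ i $ j \<ge> 0" and "\<And>j. (\<Sum>i\<in>UNIV. M $ i $ j) = c"
  shows "(\<Sum>i\<in>UNIV. \<bar>(matrix_power M k *v x) $ i\<bar>) \<le> c ^ k * (\<Sum>j\<in>UNIV. \<bar>x $ j\<bar>)"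
proof (induction k)
  case (Suc k)
  \<comment> \<open>\<open>c\<close> is the sum of any column; the index type is nonempty, so
    \<open>undefined\<close> names one.\<close>
  have "c \<ge> 0"
    unfolding assms(2)[of undefined, symmetric] by (intro sum_nonneg assms(1))
  from mult_left_mono[OF Suc this] show ?case
    using sum_abs_matrix_vector_mult_le[OF assms, of "matrix_power M k *v x"]
    by (simp add: mult.assoc flip: matrix_vector_mul_assoc)
qed simp

text \<open>The entry sum is a bounded linear functional. Integrability matters: otherwise the left
  integral is 0 by default, while the entry sum may still have a nonzero integral.\<close>

lemma sum_vec_nth_integral:
  fixes f :: "'b \<Rightarrow> real ^ 'n"
  assumes "integrable M f"
  shows "(\<Sum>i\<in>UNIV. integral\<^sup>L M f $ i) = (LINT x|M. (\<Sum>i\<in>UNIV. f x $ i))"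
  by (rule integral_bounded_linear[OF _ assms, symmetric])
    (intro bounded_linear_sum bounded_linear_vec_nth)

text \<open>A measure with a probability measure as image has total mass 1; the marginal on the
  empty index set is such an image.\<close>

lemma (in Ionescu_Tulcea) prob_space_lim: "prob_space PF.lim"
proof (rule prob_space_distrD)
  show "(\<lambda>x. restrict x {}) \<in> PF.lim \<rightarrow>\<^sub>M PiM {} M"
    by (simp add: measurable_cong_sets[OF PF.sets_lim refl] measurable_restrict)
  show "prob_space (distr PF.lim (PiM {} M) (\<lambda>x. restrict x {}))"
    unfolding distr_lim[OF finite.emptyI] by (rule PF.prob_space_P) auto
qed

lemma
  assumes "gmdp G" and "joint_policy G \<pi>" and "s \<in> space (state_space G)"
  shows prob_space_trajectory_law: "prob_space (trajectory_law G \<pi> s)"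
    and sets_trajectory_law: "sets (trajectory_law G \<pi> s) = sets (PiM UNIV (\<lambda>_. step_space G))"
proof -
  interpret Ionescu_Tulcea "step_kernel G \<pi> s" "\<lambda>_. step_space G"
    by (rule Ionescu_Tulcea_step_kernel[OF assms])
  show "prob_space (trajectory_law G \<pi> s)"
    unfolding trajectory_law_def by (rule prob_space_lim)
  show "sets (trajectory_law G \<pi> s) = sets (PiM UNIV (\<lambda>_. step_space G))"
    unfolding trajectory_law_def by (rule PF.sets_lim)
qed

lemma borel_measurable_vec:
  fixes f :: "'b \<Rightarrow> real ^ 'n"
  assumes "\<And>i. (\<lambda>x. f x $ i) \<in> borel_measurable M"
  shows "f \<in> borel_measurable M"
  using assms by (subst borel_measurable_euclidean_space) (auto simp: Basis_vec_def inner_axis)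

lemma borel_measurable_local_rewards:
  assumes "gmdp G"
  shows "local_rewards G \<in> borel_measurable (step_space G)"
proof (rule borel_measurable_vec)
  show "(\<lambda>x. local_rewards G x $ i) \<in> borel_measurable (step_space G)" for i
    using assms unfolding local_rewards_def gmdp_def
    by (auto intro: measurable_compose[OF measurable_local_view])
qed

text \<open>
  The series is controlled only on the space of the trajectory law: off the local input space the
  rewards are arbitrary.
\<close>

lemma sum_diffusion_value:
  fixes G :: "('n::finite, 'z, 's, 'a) gmdp"
  assumes G: "gmdp G" and bdd: "bounded_local_rewards G" and \<gamma>: "0 < \<gamma>" "\<gamma> < 1"
    and \<pi>: "joint_policy G \<pi>" and s: "s \<in> space (state_space G)"
  shows "(\<Sum>i\<in>UNIV. diffusion_value G \<gamma> \<pi> s $ i) = real CARD('n) * global_value G \<gamma> \<pi> s"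
proof -
  let ?P = "trajectory_law G \<pi> s" and ?\<Gamma> = "diffusion_matrix (edges G) \<gamma>"
  define g where "g \<omega> t = matrix_power ?\<Gamma> (t + 1) *v local_rewards G (\<omega> t)" for \<omega> t
  interpret P: prob_space ?P
    by (rule prob_space_trajectory_law[OF G \<pi> s])
  have loops: "(i, i) \<in> edges G" for i
    using G by (simp add: gmdp_def)
  note nonneg = diffusion_matrix_nonneg[OF loops less_imp_le[OF \<gamma>(1)]]
  note col = diffusion_matrix_column_sum[OF loops, of \<gamma>]
  obtain B where B: "\<And>i x. x \<in> space (local_input_space G i) \<Longrightarrow> \<bar>local_reward G i x\<bar> \<le> B"
    using bdd by (auto simp: bounded_local_rewards_def)
  define C where "C = real CARD('n) * B"
  have coord: "(\<lambda>\<omega>. \<omega> t) \<in> ?P \<rightarrow>\<^sub>M step_space G" for t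
    by (simp add: measurable_cong_sets[OF sets_trajectory_law[OF G \<pi> s] refl])
  \<comment> \<open>The Euclidean norm is at most the l1 norm, the norm that column sums control.
    \<open>C\<close> bounds the l1 norm of a reward vector, and \<open>coord\<close> ensures that
    the bound \<open>B\<close> applies at \<omega>.\<close>
  have norm_g: "norm (g \<omega> t) \<le> \<gamma> ^ (t + 1) * C" if \<omega>: "\<omega> \<in> space ?P" for \<omega> t
  proof -
    have "\<bar>local_rewards G (\<omega> t) $ i\<bar> \<le> B" for i
      using measurable_space[OF measurable_local_view measurable_space[OF coord \<omega>]]
      by (simp add: local_rewards_def B)
    then have "(\<Sum>i\<in>UNIV. \<bar>local_rewards G (\<omega> t) $ i\<bar>) \<le> C"
      using sum_bounded_above[of UNIV "\<lambda>i. \<bar>local_rewards G (\<omega> t) $ i\<bar>" B] by (simp add: C_def)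
    then have "\<gamma> ^ (t + 1) * (\<Sum>i\<in>UNIV. \<bar>local_rewards G (\<omega> t) $ i\<bar>) \<le> \<gamma> ^ (t + 1) * C"
      using \<gamma> by (intro mult_left_mono) auto
    with norm_le_l1_cart[of "g \<omega> t"] show ?thesis
      using sum_abs_matrix_power_mult_le[OF nonneg col, of "t + 1" "local_rewards G (\<omega> t)"]
      unfolding g_def by linarith
  qed
  have geom: "summable (\<lambda>t. \<gamma> ^ (t + 1) * C)"
    using \<gamma> summable_ignore_initial_segment[OF summable_geometric[of \<gamma>], of 1]
    by (intro summable_mult2) simp
  \<comment> \<open>The geometric majorant is independent of \<omega>, so the series is bounded by a
    constant on a probability space.\<close>
  have "integrable ?P (\<lambda>\<omega>. \<Sum>t. g \<omega> t)"
  proof (rule P.integrable_const_bound)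
    show "AE \<omega> in ?P. norm (\<Sum>t. g \<omega> t) \<le> (\<Sum>t. \<gamma> ^ (t + 1) * C)"
      using norm_g geom by (intro AE_I2 norm_suminf_le)
    have "(\<lambda>\<omega>. g \<omega> t) \<in> borel_measurable ?P" for t
      unfolding g_def
      by (rule borel_measurable_continuous_on[OF matrix_vector_mult_linear_continuous_on
            measurable_compose[OF coord borel_measurable_local_rewards[OF G]]])
    then show "(\<lambda>\<omega>. \<Sum>t. g \<omega> t) \<in> borel_measurable ?P"
      by (rule borel_measurable_suminf)
  qed
  then have "(\<Sum>i\<in>UNIV. diffusion_value G \<gamma> \<pi> s $ i) = (LINT \<omega>|?P. (\<Sum>i\<in>UNIV. (\<Sum>t. g \<omega> t) $ i))"
    unfolding diffusion_value_def g_def by (rule sum_vec_nth_integral)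
  also have "\<dots> = (LINT \<omega>|?P. real CARD('n) * (\<Sum>t. \<gamma> ^ (t + 1) * global_reward G (\<omega> t)))"
  proof (rule Bochner_Integration.integral_cong[OF refl])
    fix \<omega> assume \<omega>: "\<omega> \<in> space ?P"
    \<comment> \<open>The factor \<open>real CARD('n)\<close> undoes the averaging in
      \<open>global_reward\<close>.\<close>
    have g: "(\<Sum>i\<in>UNIV. g \<omega> t $ i) = real CARD('n) * (\<gamma> ^ (t + 1) * global_reward G (\<omega> t))" for t
      unfolding g_def sum_matrix_power_mult[OF col] by (simp add: local_rewards_def global_reward_def)
    have summable: "summable (g \<omega>)"
      by (rule summable_comparison_test'[OF geom norm_g[OF \<omega>]])
    have bl: "bounded_linear (\<lambda>x :: real ^ 'n. \<Sum>i\<in>UNIV. x $ i)"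
      by (intro bounded_linear_sum bounded_linear_vec_nth)
    \<comment> \<open>Summability of the scalar series, needed to pull out the constant, is
      inherited from the vector series through the entry sum.\<close>
    have "summable (\<lambda>t. real CARD('n) * (\<gamma> ^ (t + 1) * global_reward G (\<omega> t)))"
      using bounded_linear.summable[OF bl summable] unfolding g .
    then have "summable (\<lambda>t. \<gamma> ^ (t + 1) * global_reward G (\<omega> t))"
      by (subst (asm) summable_cmult_iff) auto
    then show "(\<Sum>i\<in>UNIV. (\<Sum>t. g \<omega> t) $ i)
        = real CARD('n) * (\<Sum>t. \<gamma> ^ (t + 1) * global_reward G (\<omega> t))"
      unfolding bounded_linear.suminf[OF bl summable] g by (rule suminf_mult)
  qed
  also have "\<dots> = real CARD('n) * global_value G \<gamma> \<pi> s"
    by (simp add: global_value_def)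
  finally show ?thesis .
qed

theorem proposition3p4:
  fixes G :: "('n::finite, 'z, 's, 'a) gmdp"
    and \<gamma> :: real
    and \<pi> \<pi>' :: "('n, 's, 'a) policy"
    and S :: "('n, 'z, 's) state"
  assumes "gmdp G"
    and "bounded_local_rewards G"
    and "0 < \<gamma>" and "\<gamma> < 1"
    and "joint_policy G \<pi>" and "joint_policy G \<pi>'"
    and "S \<in> space (state_space G)"
    and "\<forall>i. diffusion_value G \<gamma> \<pi>' S $ i \<ge> diffusion_value G \<gamma> \<pi> S $ i"
    and "\<exists>i. diffusion_value G \<gamma> \<pi>' S $ i > diffusion_value G \<gamma> \<pi> S $ i"
  shows "global_value G \<gamma> \<pi>' S > global_value G \<gamma> \<pi> S"
proof -
  have "(\<Sum>i\<in>UNIV. diffusion_value G \<gamma> \<pi> S $ i) < (\<Sum>i\<in>UNIV. diffusion_value G \<gamma> \<pi>' S $ i)"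
    using assms(8,9) by (intro sum_strict_mono_ex1) auto
  \<comment> \<open>Both entry sums are the global values times the same positive factor
    \<open>real CARD('n)\<close>, which cancels.\<close>
  then show ?thesis
    by (simp add: sum_diffusion_value assms)
qed

end
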